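(* Let $$C^*=\frac{-1+2tz+2tz^2-2t^2z^2+\sqrt{1-4tz-4tz^2+4t^2z^2}}{2t^2z(tz-z-1)}.$$ Define the power series $A(t,p)$ and $B(t,p)$ in $z$ by $$pzA(t,p)=\sum_{n\ge1}z^n\sum_{\substack{\pi\in\mathfrak{S}_n(123)\\ \mathsf{iar}(\pi)=1}}t^{\mathsf{des}(\pi)}p^{\mathsf{comp}(\pi)},\qquad pzB(t,p)=\sum_{n\ge2}z^n\sum_{\substack{\pi\in\mathfrak{S}_n(123)\\ \mathsf{iar}(\pi)=2}}t^{\mathsf{des}(\pi)}p^{\mathsf{comp}(\pi)}.$$ Then $$A(t,p)=\frac{(p-1)tz^2}{(1-tz)^2}+\frac{(1-tz)C^*}{(1-tz+z)z},\qquad B(t,p)=\frac{(p-1)z}{1-tz}+\frac{C^*}{1-tz+z}.$$ Thus, $$\tilde{\mathfrak{S}}(123)^{\mathsf{des},\mathsf{iar},\mathsf{comp}}(t,r,p)=\frac{(1-p)z(trz-tz-r)}{(1-tz)^2}+\frac{(1+rz-tz)C^*}{z(1+z-tz)}.$$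
   Context: $\mathfrak{S}_n$ is the set of permutations $\pi=\pi(1)\cdots\pi(n)$ of $[n]=\{1,\dots,n\}$. A permutation $\pi\in\mathfrak{S}_n$ contains the pattern $\sigma\in\mathfrak{S}_k$ if there are $j_1<\cdots<j_k$ such that $\pi(j_a)<\pi(j_b)$ if and only if $\sigma(a)<\sigma(b)$ for all $1\le a<b\le k$; otherwise it avoids $\sigma$. For a set $P$ of patterns, $\mathfrak{S}_n(P)$ is the set of $\pi\in\mathfrak{S}_n$ avoiding every pattern in $P$. For $\pi\in\mathfrak{S}_n$: $\mathrm{DES}(\pi)=\{i\in[n-1]:\pi(i)>\pi(i+1)\}$, $\mathsf{des}(\pi)=|\mathrm{DES}(\pi)|$, $\mathsf{iar}(\pi)=\min(\mathrm{DES}(\pi)\cup\{n\})$, $\mathsf{comp}(\pi)=|\{i\in[n]:\pi(j)\le i\text{ for all }j\le i\}|$. Define the formal power series in $z$ $$\mathfrak{S}(P)^{\mathsf{des},\mathsf{iar},\mathsf{comp}}(t,r,p;z)=\sum_{n\ge0}z^n\sum_{\pi\in\mathfrak{S}_n(P)}t^{\mathsf{des}(\pi)}r^{\mathsf{iar}(\pi)}p^{\mathsf{comp}(\pi)},$$ where the empty permutation ($n=0$) contributes $1$, and $\tilde{\mathfrak{S}}(P)^{\mathsf{des},\mathsf{iar},\mathsf{comp}}(t,r,p)=\big(\mathfrak{S}(P)^{\mathsf{des},\mathsf{iar},\mathsf{comp}}(t,r,p;z)-1\big)/(rpz)$. Square roots denote the formal power series with constant term $1$; the series $C^*$ equals $\sum_{n\ge1}z^n\sum_{\pi\in\mathfrak{S}_n(123)}t^{\mathsf{des}(\pi)}$.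 *)

theory Defs
  imports
    "HOL-Computational_Algebra.Computational_Algebra"
    "HOL-Combinatorics.Permutations"
begin

section \<open>Pattern avoidance\<close>

text \<open>
  A permutation in $S_n$ is a function \<open>\<pi> :: nat \<Rightarrow> nat\<close> with \<open>\<pi> permutes {1..n}\<close>; such a function
  is the identity outside \<open>{1..n}\<close>, so it does not determine \<open>n\<close>, which is passed along explicitly.
  A pattern is likewise a pair \<open>(k, \<sigma>)\<close> with \<open>\<sigma> permutes {1..k}\<close>.
\<close>

definition contains_pattern :: "nat \<Rightarrow> (nat \<Rightarrow> nat) \<Rightarrow> nat \<times> (nat \<Rightarrow> nat) \<Rightarrow> bool" where
  "contains_pattern n \<pi> = (\<lambda>(k, \<sigma>). \<exists>j :: nat \<Rightarrow> nat.
     strict_mono_on {1..k} j \<and> j ` {1..k} \<subseteq> {1..n} \<and>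
     (\<forall>a b. 1 \<le> a \<and> a < b \<and> b \<le> k \<longrightarrow> (\<pi> (j a) < \<pi> (j b) \<longleftrightarrow> \<sigma> a < \<sigma> b)))"

definition avoiders :: "(nat \<times> (nat \<Rightarrow> nat)) set \<Rightarrow> nat \<Rightarrow> (nat \<Rightarrow> nat) set" where
  "avoiders P n = {\<pi>. \<pi> permutes {1..n} \<and> (\<forall>\<tau>\<in>P. \<not> contains_pattern n \<pi> \<tau>)}"

definition pattern_123 :: "nat \<times> (nat \<Rightarrow> nat)" where
  "pattern_123 = (3, id)"

section \<open>Statistics\<close>

definition descent_set :: "nat \<Rightarrow> (nat \<Rightarrow> nat) \<Rightarrow> nat set" where
  "descent_set n \<pi> = {i \<in> {1..n-1}. \<pi> i > \<pi> (i + 1)}"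

definition des :: "nat \<Rightarrow> (nat \<Rightarrow> nat) \<Rightarrow> nat" where
  "des n \<pi> = card (descent_set n \<pi>)"

definition iar :: "nat \<Rightarrow> (nat \<Rightarrow> nat) \<Rightarrow> nat" where
  "iar n \<pi> = Min (descent_set n \<pi> \<union> {n})"

definition comps :: "nat \<Rightarrow> (nat \<Rightarrow> nat) \<Rightarrow> nat" where
  "comps n \<pi> = card {i \<in> {1..n}. \<forall>j\<in>{1..i}. \<pi> j \<le> i}"

section \<open>Generating functions\<close>

text \<open>
  Series in $z$ are formal power series over a field \<open>'a\<close> containing \<open>t\<close>, \<open>r\<close>, \<open>p\<close>. Quotients of
  series are taken in the field \<open>'a fls\<close> of formal Laurent series, because \<open>/\<close> on \<open>'a fps\<close>
  discards the principal part when the denominator does not divide the numerator.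
\<close>

definition gf_des_iar_comp ::
    "(nat \<times> (nat \<Rightarrow> nat)) set \<Rightarrow> 'a::field \<Rightarrow> 'a \<Rightarrow> 'a \<Rightarrow> 'a fps" where
  "gf_des_iar_comp P t r p =
     Abs_fps (\<lambda>n. \<Sum>\<pi>\<in>avoiders P n. t ^ des n \<pi> * r ^ iar n \<pi> * p ^ comps n \<pi>)"

definition gf_tilde ::
    "(nat \<times> (nat \<Rightarrow> nat)) set \<Rightarrow> 'a::field \<Rightarrow> 'a \<Rightarrow> 'a \<Rightarrow> 'a fls" where
  "gf_tilde P t r p =
     (fps_to_fls (gf_des_iar_comp P t r p) - 1) / (fls_const r * fls_const p * fls_X)"

definition fps_sqrt :: "'a::field_char_0 fps \<Rightarrow> 'a fps" where
  "fps_sqrt f = fps_radical (\<lambda>_ _. 1) 2 f"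

lemma fps_sqrt_unique:
  fixes f g :: "'a::field_char_0 fps"
  assumes "fps_nth f 0 = 1"
  shows "g = fps_sqrt f \<longleftrightarrow> g ^ 2 = f \<and> fps_nth g 0 = 1"
proof -
  have "fps_nth (fps_sqrt f) 0 = 1"
    by (simp add: fps_sqrt_def numeral_2_eq_2)
  moreover have "g ^ 2 = f \<longleftrightarrow> g = fps_sqrt f" if "fps_nth g 0 = 1"
    using radical_unique[of "\<lambda>_ _. 1" 1 f g] assms that
    by (simp add: fps_sqrt_def numeral_2_eq_2)
  ultimately show ?thesis by metis
qed

definition C_star :: "'a::field_char_0 \<Rightarrow> 'a fls" where
  "C_star t =
     (let \<t> = fls_const t; z = fls_X;
          S = fps_sqrt (1 - 4 * fps_const t * fps_X - 4 * fps_const t * fps_X ^ 2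
                          + 4 * fps_const t ^ 2 * fps_X ^ 2)
      in (- 1 + 2 * \<t> * z + 2 * \<t> * z ^ 2 - 2 * \<t> ^ 2 * z ^ 2 + fps_to_fls S)
           / (2 * \<t> ^ 2 * z * (\<t> * z - z - 1)))"

section \<open>The indeterminates\<close>

text \<open>The field $\mathbb{Q}(t, r, p)$ of rational functions.\<close>

type_synonym ratfun = "rat poly poly poly fract"

definition t_var :: ratfun where "t_var = Fract [:[:[:0, 1:]:]:] 1"
definition r_var :: ratfun where "r_var = Fract [:[:0, 1:]:] 1"
definition p_var :: ratfun where "p_var = Fract [:0, 1:] 1"

lemma vars_nonzero: "t_var \<noteq> 0" "r_var \<noteq> 0" "p_var \<noteq> 0"
  by (simp_all add: t_var_def r_var_def p_var_def Zero_fract_def eq_fract)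

text \<open>An equation $p z A = F$ determines the power series $A$ whenever $F$ has no constant term.\<close>

lemma ex1_fps_const_X_mult:
  fixes c :: "'a::field" and F :: "'a fps"
  assumes "c \<noteq> 0" "fps_nth F 0 = 0"
  shows "\<exists>!A. fps_const c * fps_X * A = F"
proof
  show "fps_const c * fps_X * (fps_const (inverse c) * fps_shift 1 F) = F"
    using assms
    by (auto simp: fps_eq_iff mult.assoc fps_mult_left_const_nth)
next
  fix A assume A: "fps_const c * fps_X * A = F"
  show "A = fps_const (inverse c) * fps_shift 1 F"
    unfolding A[symmetric] using assms
    by (auto simp: fps_eq_iff mult.assoc)
qed

end

theory Submission
  imports Defs
begin

text \<open>
  Write \<open>av n\<close> for the set of permutations of \<open>{1..n}\<close> that avoid 123, and let \<open>run \<pi>\<close> be the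
  length of the initial decreasing run of \<open>\<pi>\<close>. The theorem combines three facts.

  First, the maximum \<open>n + 1\<close> can be inserted into \<open>\<pi> \<in> av n\<close> right after the first \<open>j\<close> entries,
  without creating a 123, exactly when those entries decrease, that is, when \<open>j \<le> run \<pi>\<close>; and
  every element of \<open>av (n + 1)\<close> arises once (\<open>bij_betw_insert_max\<close>). The insertion changes the
  run to \<open>run \<pi> + 1\<close> if \<open>j = 0\<close> and to \<open>j\<close> otherwise, and its effect on \<open>des\<close> depends on \<open>j\<close>,
  \<open>run \<pi>\<close> and \<open>n\<close> only. So the sums \<open>run_weight t n d\<close> of \<open>t ^ des n \<pi>\<close> over the permutations
  with run \<open>d\<close> satisfy a linear recurrence (\<open>run_weight_Suc\<close>).

  The kernel of this recurrence is quadratic. Its root that vanishes at $z = 0$ is the series $y$ with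
  $y = tz + w y^2$, where $w = 1 + z - tz$. The recurrence is solved by a combination of
  $y^d$ and $(tz)^d$ (\<open>run_weight_eq_run_series\<close>). Summing over \<open>d\<close> gives
  $(y - tz) / (t^2 z)$ for all of \<open>av\<close>, which is $C^*$ once $y$ is expressed by the
  square root of its discriminant (\<open>tail_series_C_star\<close>). The case \<open>d = 1\<close> gives $z + y^2/t^2$.

  Second, for \<open>n \<ge> 2\<close> the statistic \<open>iar\<close> is 2 if \<open>run \<pi> = 1\<close> and 1 otherwise, since an ascent at
  position 1 is followed by a descent or by nothing (\<open>iar_av\<close>). Hence the case $p = 1$ of the theorem is
  the relation $w (y^2/t^2) = z C^*$ (\<open>w_series_run_series_1\<close>).

  Third, for \<open>n \<ge> 1\<close> the statistic \<open>comps\<close> is 1 except on direct sums of two decreasing permutations, where it is 2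
  (\<open>comps_av\<close>). There are \<open>n - 1\<close> such sums of size \<open>n\<close>, one for each size \<open>k\<close> of the first summand;
  they have \<open>n - 2\<close> descents, and \<open>k\<close> is their run. They contribute the summands with the
  factor $p - 1$.
\<close>

section \<open>Permutations that avoid 123\<close>

abbreviation av :: "nat \<Rightarrow> (nat \<Rightarrow> nat) set" where
  "av n \<equiv> avoiders {pattern_123} n"

lemma av_iff:
  "\<pi> \<in> av n \<longleftrightarrow> \<pi> permutes {1..n} \<and>
     (\<forall>a b c. 1 \<le> a \<longrightarrow> a < b \<longrightarrow> b < c \<longrightarrow> c \<le> n \<longrightarrow> \<not> (\<pi> a < \<pi> b \<and> \<pi> b < \<pi> c))"
proof -
  have "contains_pattern n \<pi> (3, id) \<longleftrightarrow>
      (\<exists>a b c. 1 \<le> a \<and> a < b \<and> b < c \<and> c \<le> n \<and> \<pi> a < \<pi> b \<and> \<pi> b < \<pi> c)" (is "?L \<longleftrightarrow> ?R")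
  proof
    assume ?L
    then obtain j :: "nat \<Rightarrow> nat" where mono: "strict_mono_on {1..3} j" and im: "j ` {1..3} \<subseteq> {1..n}"
      and ord: "\<And>a b. 1 \<le> a \<Longrightarrow> a < b \<Longrightarrow> b \<le> (3::nat) \<Longrightarrow> \<pi> (j a) < \<pi> (j b)"
      by (auto simp: contains_pattern_def)
    have "j 1 < j 2" "j 2 < j 3"
      using mono by (auto intro!: strict_mono_onD[of "{1..3}" j])
    moreover have "1 \<le> j 1" "j 3 \<le> n"
      using im by (auto simp: image_subset_iff)
    ultimately show ?R
      using ord[of 1 2] ord[of 2 3] by auto
  next
    assume ?R
    then obtain a b c where abc: "1 \<le> a" "a < b" "b < c" "c \<le> n" "\<pi> a < \<pi> b" "\<pi> b < \<pi> c"
      by blast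
    define j :: "nat \<Rightarrow> nat" where "j = (\<lambda>i. if i = 1 then a else if i = 2 then b else c)"
    have "strict_mono_on {1..3} j" "j ` {1..3} \<subseteq> {1..n}"
      using abc by (auto simp: strict_mono_on_def j_def)
    moreover have "\<pi> (j x) < \<pi> (j y)" if "1 \<le> x" "x < y" "y \<le> 3" for x y
    proof -
      have "x = 1 \<and> y = 2 \<or> x = 1 \<and> y = 3 \<or> x = 2 \<and> y = 3"
        using that by auto
      then show ?thesis
        using abc by (auto simp: j_def)
    qed
    ultimately show ?L
      unfolding contains_pattern_def by (auto intro!: exI[of _ j])
  qed
  then show ?thesis
    by (auto simp: avoiders_def pattern_123_def)
qed

lemma av_permutes: "\<pi> \<in> av n \<Longrightarrow> \<pi> permutes {1..n}"
  by (simp add: av_iff)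

lemma av_no_123:
  "\<pi> \<in> av n \<Longrightarrow> 1 \<le> a \<Longrightarrow> a < b \<Longrightarrow> b < c \<Longrightarrow> c \<le> n \<Longrightarrow> \<pi> a < \<pi> b \<Longrightarrow> \<pi> b < \<pi> c \<Longrightarrow> False"
  by (auto simp: av_iff)

lemma finite_av: "finite (av n)"
  by (rule finite_subset[OF _ finite_permutations[of "{1..n}"]]) (auto dest: av_permutes simp del: One_nat_def)

lemma permutes_inj_eq: "\<pi> permutes S \<Longrightarrow> \<pi> a = \<pi> b \<longleftrightarrow> a = b"
  by (metis permutes_inj injD)

lemma permutes_interval_bounds:
  assumes "\<pi> permutes {1..n::nat}" "1 \<le> i" "i \<le> n"
  shows "1 \<le> \<pi> i" "\<pi> i \<le> n"
  using permutes_in_image[OF assms(1), of i] assms(2,3) by auto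

lemma permutes_interval_outside:
  assumes "\<pi> permutes {1..n::nat}" "n < i"
  shows "\<pi> i = i"
  using permutes_not_in[OF assms(1), of i] assms(2) by auto

lemma permutes_interval_zero:
  assumes "\<pi> permutes {1..n::nat}"
  shows "\<pi> 0 = 0"
  using permutes_not_in[OF assms(1), of 0] by auto

lemma permutes_interval_le:
  assumes "\<pi> permutes {1..n::nat}" "i \<le> n"
  shows "\<pi> i \<le> n"
  using permutes_interval_bounds[OF assms(1), of i] permutes_interval_zero[OF assms(1)] assms(2)
  by (cases "i = 0") auto

section \<open>The initial decreasing run\<close>

text \<open>
  A permutation of \<open>{1..n}\<close> fixes \<open>n + 1\<close>, so that position \<open>n\<close> is always an ascent of the function.
  This makes the least ascent exist, and it equals \<open>n\<close> for the decreasing permutation.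
\<close>

definition run :: "(nat \<Rightarrow> nat) \<Rightarrow> nat" where
  "run \<pi> = (LEAST i. 1 \<le> i \<and> \<pi> i < \<pi> (Suc i))"

lemma run_eqI:
  assumes "1 \<le> d" "\<pi> d < \<pi> (Suc d)" "\<And>i. 1 \<le> i \<Longrightarrow> i < d \<Longrightarrow> \<pi> (Suc i) \<le> \<pi> i"
  shows "run \<pi> = d"
  unfolding run_def
  by (rule Least_equality) (use assms in \<open>force simp: not_le not_less\<close>)+

lemma
  assumes "\<pi> permutes {1..n}" "1 \<le> n"
  shows run_ge_1: "1 \<le> run \<pi>" and run_le: "run \<pi> \<le> n"
    and run_ascent: "\<pi> (run \<pi>) < \<pi> (Suc (run \<pi>))"
proof -
  have *: "1 \<le> n \<and> \<pi> n < \<pi> (Suc n)"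
    using assms permutes_interval_bounds[OF assms(1), of n]
    by (simp add: permutes_interval_outside[OF assms(1)])
  show "run \<pi> \<le> n"
    unfolding run_def by (rule Least_le[of "\<lambda>i. 1 \<le> i \<and> \<pi> i < \<pi> (Suc i)", OF *])
  show "1 \<le> run \<pi>" "\<pi> (run \<pi>) < \<pi> (Suc (run \<pi>))"
    using LeastI[of "\<lambda>i. 1 \<le> i \<and> \<pi> i < \<pi> (Suc i)", OF *] by (simp_all add: run_def)
qed

lemma run_descent:
  assumes "\<pi> permutes S" "1 \<le> i" "i < run \<pi>"
  shows "\<pi> (Suc i) < \<pi> i"
  using not_less_Least[of i "\<lambda>i. 1 \<le> i \<and> \<pi> i < \<pi> (Suc i)"] assms permutes_inj_eq[OF assms(1), of i "Suc i"]
  by (auto simp: run_def)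

lemma run_decreasing:
  assumes "\<pi> permutes S" "1 \<le> a" "a < b" "b \<le> run \<pi>"
  shows "\<pi> b < \<pi> a"
  using assms(3,4)
proof (induction b)
  case (Suc b)
  then show ?case
    using run_descent[OF assms(1), of b] \<open>1 \<le> a\<close> by (cases "a = b") force+
qed simp

lemma le_run_iff:
  assumes "\<pi> permutes {1..n}" "1 \<le> n" "j \<le> n"
  shows "j \<le> run \<pi> \<longleftrightarrow> (\<forall>a b. 1 \<le> a \<longrightarrow> a < b \<longrightarrow> b \<le> j \<longrightarrow> \<pi> b < \<pi> a)"
proof
  assume "j \<le> run \<pi>"
  then show "\<forall>a b. 1 \<le> a \<longrightarrow> a < b \<longrightarrow> b \<le> j \<longrightarrow> \<pi> b < \<pi> a"
    using run_decreasing[OF assms(1)] by simp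
next
  assume *: "\<forall>a b. 1 \<le> a \<longrightarrow> a < b \<longrightarrow> b \<le> j \<longrightarrow> \<pi> b < \<pi> a"
  show "j \<le> run \<pi>"
  proof (rule ccontr)
    assume "\<not> j \<le> run \<pi>"
    then have "\<pi> (Suc (run \<pi>)) < \<pi> (run \<pi>)"
      using * run_ge_1[OF assms(1,2)] by simp
    then show False
      using run_ascent[OF assms(1,2)] by simp
  qed
qed

section \<open>Insertion of the maximum\<close>

definition insert_max :: "nat \<Rightarrow> nat \<Rightarrow> (nat \<Rightarrow> nat) \<Rightarrow> nat \<Rightarrow> nat" where
  "insert_max n j \<pi> = (\<lambda>i. if i \<le> j then \<pi> i else if i = Suc j then Suc n
                          else if i \<le> Suc n then \<pi> (i - 1) else i)"

definition delete_max :: "nat \<Rightarrow> nat \<Rightarrow> (nat \<Rightarrow> nat) \<Rightarrow> nat \<Rightarrow> nat" where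
  "delete_max n j \<pi> = (\<lambda>i. if i \<le> j then \<pi> i else if i \<le> n then \<pi> (Suc i) else i)"

lemma permutes_intervalI:
  assumes "\<And>i. 1 \<le> i \<Longrightarrow> i \<le> n \<Longrightarrow> 1 \<le> f i \<and> f i \<le> n"
    and "\<And>i k. 1 \<le> i \<Longrightarrow> i < k \<Longrightarrow> k \<le> n \<Longrightarrow> f i \<noteq> f k"
    and "f 0 = 0" and "\<And>i. n < i \<Longrightarrow> f i = i"
  shows "f permutes {1..n::nat}"
proof (rule bij_imp_permutes)
  have "inj_on f {1..n}"
    using assms(2) by (intro linorder_inj_onI) auto
  moreover have "f ` {1..n} \<subseteq> {1..n}"
    using assms(1) by auto
  ultimately show "bij_betw f {1..n} {1..n}"
    by (simp add: bij_betw_def endo_inj_surj)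
  show "f x = x" if "x \<notin> {1..n}" for x
    using that assms(3,4) by (cases "x = 0") auto
qed

text \<open>
  The new maximum can only play the 3 of a 123, and the entries before it form a decreasing run.
\<close>

lemma insert_max_in_av:
  assumes "\<pi> \<in> av n" "1 \<le> n" "j \<le> run \<pi>"
  shows "insert_max n j \<pi> \<in> av (Suc n)"
proof -
  note perm = av_permutes[OF assms(1)]
  note bounds = permutes_interval_bounds[OF perm]
  have jn: "j \<le> n"
    using assms run_le[OF perm] by simp
  define \<phi> where "\<phi> i = (if i \<le> j then i else i - 1)" for i
  have eq: "insert_max n j \<pi> i = \<pi> (\<phi> i)" if "i \<le> Suc n" "i \<noteq> Suc j" for i
    using that by (auto simp: insert_max_def \<phi>_def)
  have \<phi>: "1 \<le> \<phi> i" "\<phi> i \<le> n" if "1 \<le> i" "i \<le> Suc n" "i \<noteq> Suc j" for i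
    using that jn by (auto simp: \<phi>_def)
  have max: "insert_max n j \<pi> (Suc j) = Suc n"
    by (simp add: insert_max_def)
  have le: "insert_max n j \<pi> i \<le> n" if "1 \<le> i" "i \<le> Suc n" "i \<noteq> Suc j" for i
    using eq[of i] \<phi>[of i] bounds[of "\<phi> i"] that by simp
  have perm': "insert_max n j \<pi> permutes {1..Suc n}"
  proof (rule permutes_intervalI)
    fix i assume "1 \<le> i" "i \<le> Suc n"
    then show "1 \<le> insert_max n j \<pi> i \<and> insert_max n j \<pi> i \<le> Suc n"
      using eq[of i] \<phi>[of i] bounds[of "\<phi> i"] max by (cases "i = Suc j") simp_all
  next
    fix i k assume ik: "1 \<le> i" "i < k" "k \<le> Suc n"
    show "insert_max n j \<pi> i \<noteq> insert_max n j \<pi> k"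
    proof (cases "i = Suc j \<or> k = Suc j")
      case True
      then show ?thesis
        using le[of i] le[of k] max ik by auto
    next
      case False
      then have "\<phi> i \<noteq> \<phi> k"
        using ik by (auto simp: \<phi>_def)
      then show ?thesis
        using eq[of i] eq[of k] False ik permutes_inj_eq[OF perm, of "\<phi> i" "\<phi> k"] by simp
    qed
  qed (use jn permutes_interval_zero[OF perm] in \<open>auto simp: insert_max_def\<close>)
  moreover have False
    if abc: "1 \<le> a" "a < b" "b < c" "c \<le> Suc n"
      and asc: "insert_max n j \<pi> a < insert_max n j \<pi> b" "insert_max n j \<pi> b < insert_max n j \<pi> c"
    for a b c
  proof -
    have "insert_max n j \<pi> c \<le> Suc n"
      using abc by (intro permutes_interval_le[OF perm'])
    then have ab: "a \<noteq> Suc j" "b \<noteq> Suc j"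
      using asc by (auto simp: insert_max_def)
    show False
    proof (cases "c = Suc j")
      case True
      then have "\<pi> a < \<pi> b"
        using abc asc by (auto simp: insert_max_def)
      then show False
        using run_decreasing[OF perm, of a b] abc True assms(3) by auto
    next
      case False
      then have "\<pi> (\<phi> a) < \<pi> (\<phi> b)" "\<pi> (\<phi> b) < \<pi> (\<phi> c)"
        using asc abc ab by (simp_all add: eq)
      moreover have "1 \<le> \<phi> a" "\<phi> a < \<phi> b" "\<phi> b < \<phi> c" "\<phi> c \<le> n"
        using abc ab False jn by (auto simp: \<phi>_def)
      ultimately show False
        using av_no_123[OF assms(1)] by blast
    qed
  qed
  ultimately show ?thesis
    by (auto simp: av_iff simp del: One_nat_def)
qed

text \<open>
  An ascent before the maximum would form a 123 with it, so the entries in front of the maximum decrease.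
\<close>

lemma delete_max_in_av:
  assumes "\<pi> \<in> av (Suc n)" "1 \<le> n" "j \<le> n" "\<pi> (Suc j) = Suc n"
  shows "delete_max n j \<pi> \<in> av n" and "j \<le> run (delete_max n j \<pi>)"
proof -
  note perm = av_permutes[OF assms(1)]
  note bounds = permutes_interval_bounds[OF perm]
  have le: "\<pi> i \<le> n" if "1 \<le> i" "i \<le> Suc n" "i \<noteq> Suc j" for i
    using bounds[of i] that permutes_inj_eq[OF perm, of i "Suc j"] assms(4) by auto
  have perm': "delete_max n j \<pi> permutes {1..n}"
  proof (rule permutes_intervalI)
    fix i assume "1 \<le> i" "i \<le> n"
    then show "1 \<le> delete_max n j \<pi> i \<and> delete_max n j \<pi> i \<le> n"
      using bounds[of i] bounds[of "Suc i"] le[of i] le[of "Suc i"] by (auto simp: delete_max_def)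
  next
    fix i k assume "1 \<le> i" "i < k" "k \<le> n"
    then show "delete_max n j \<pi> i \<noteq> delete_max n j \<pi> k"
      by (auto simp: delete_max_def permutes_inj_eq[OF perm])
  qed (use assms permutes_interval_zero[OF perm] in \<open>auto simp: delete_max_def\<close>)
  have False
    if abc: "1 \<le> a" "a < b" "b < c" "c \<le> n"
      and asc: "delete_max n j \<pi> a < delete_max n j \<pi> b" "delete_max n j \<pi> b < delete_max n j \<pi> c"
    for a b c
  proof -
    define \<phi> where "\<phi> i = (if i \<le> j then i else Suc i)" for i
    have eq: "delete_max n j \<pi> i = \<pi> (\<phi> i)" if "i \<le> n" for i
      using that by (auto simp: delete_max_def \<phi>_def)
    have "\<pi> (\<phi> a) < \<pi> (\<phi> b)" "\<pi> (\<phi> b) < \<pi> (\<phi> c)"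
      using asc abc by (simp_all add: eq)
    moreover have "1 \<le> \<phi> a" "\<phi> a < \<phi> b" "\<phi> b < \<phi> c" "\<phi> c \<le> Suc n"
      using abc by (auto simp: \<phi>_def)
    ultimately show False
      using av_no_123[OF assms(1)] by blast
  qed
  with perm' show "delete_max n j \<pi> \<in> av n"
    by (auto simp: av_iff simp del: One_nat_def)
  have "\<pi> b < \<pi> a" if "1 \<le> a" "a < b" "b \<le> j" for a b
  proof (rule ccontr)
    assume "\<not> \<pi> b < \<pi> a"
    then have "\<pi> a < \<pi> b"
      using that permutes_inj_eq[OF perm, of a b] by auto
    moreover have "\<pi> b < \<pi> (Suc j)"
      using le[of b] that assms by auto
    ultimately show False
      using av_no_123[OF assms(1), of a b "Suc j"] that assms(3) by auto
  qed
  then show "j \<le> run (delete_max n j \<pi>)"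
    using le_run_iff[OF perm' assms(2,3)] by (auto simp: delete_max_def)
qed

lemma bij_betw_insert_max:
  assumes "1 \<le> n" "j \<le> n"
  shows "bij_betw (insert_max n j) {\<pi> \<in> av n. j \<le> run \<pi>} {\<pi> \<in> av (Suc n). \<pi> (Suc j) = Suc n}"
proof (rule bij_betw_byWitness[where f' = "delete_max n j"])
  show "\<forall>\<pi>\<in>{\<pi> \<in> av n. j \<le> run \<pi>}. delete_max n j (insert_max n j \<pi>) = \<pi>"
    by (auto simp: fun_eq_iff delete_max_def insert_max_def
        permutes_interval_outside[OF av_permutes])
  show "\<forall>\<pi>\<in>{\<pi> \<in> av (Suc n). \<pi> (Suc j) = Suc n}. insert_max n j (delete_max n j \<pi>) = \<pi>"
  proof safe
    fix \<pi> assume \<pi>: "\<pi> \<in> av (Suc n)" "\<pi> (Suc j) = Suc n"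
    then show "insert_max n j (delete_max n j \<pi>) = \<pi>"
      using permutes_interval_outside[OF av_permutes[OF \<pi>(1)]]
      by (auto simp: fun_eq_iff delete_max_def insert_max_def)
  qed
  show "insert_max n j ` {\<pi> \<in> av n. j \<le> run \<pi>} \<subseteq> {\<pi> \<in> av (Suc n). \<pi> (Suc j) = Suc n}"
    using insert_max_in_av assms by (auto simp: insert_max_def)
  show "delete_max n j ` {\<pi> \<in> av (Suc n). \<pi> (Suc j) = Suc n} \<subseteq> {\<pi> \<in> av n. j \<le> run \<pi>}"
    using delete_max_in_av assms by auto
qed

lemma run_insert_max_0:
  assumes "\<pi> \<in> av n" "1 \<le> n"
  shows "run (insert_max n 0 \<pi>) = Suc (run \<pi>)"
proof (rule run_eqI)
  note perm = av_permutes[OF assms(1)]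
  show "insert_max n 0 \<pi> (Suc (run \<pi>)) < insert_max n 0 \<pi> (Suc (Suc (run \<pi>)))"
    using run_ge_1[OF perm assms(2)] run_le[OF perm assms(2)] run_ascent[OF perm assms(2)]
      permutes_interval_bounds[OF perm, of "run \<pi>"]
    by (auto simp: insert_max_def)
  fix i assume "1 \<le> i" "i < Suc (run \<pi>)"
  then show "insert_max n 0 \<pi> (Suc i) \<le> insert_max n 0 \<pi> i"
    using run_descent[OF perm, of "i - 1"] run_le[OF perm assms(2)]
      permutes_interval_le[OF perm, of i] assms(2)
    by (cases i rule: nat.exhaust[case_names Zero Suc]; cases "i = 1")
       (auto simp: insert_max_def less_imp_le)
qed simp

lemma run_insert_max:
  assumes "\<pi> \<in> av n" "1 \<le> j" "j \<le> run \<pi>" "1 \<le> n"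
  shows "run (insert_max n j \<pi>) = j"
proof (rule run_eqI)
  note perm = av_permutes[OF assms(1)]
  show "insert_max n j \<pi> j < insert_max n j \<pi> (Suc j)"
    using permutes_interval_bounds[OF perm, of j] run_le[OF perm] assms
    by (auto simp: insert_max_def)
  fix i assume "1 \<le> i" "i < j"
  then show "insert_max n j \<pi> (Suc i) \<le> insert_max n j \<pi> i"
    using run_descent[OF perm, of i] assms(3) by (auto simp: insert_max_def)
qed (use assms in simp)

text \<open>
  If the maximum is not the first entry, then the entries in front of it decrease and are followed
  by an ascent, so that the initial run ends right before the maximum.
\<close>

lemma max_position:
  assumes "\<pi> \<in> av (Suc n)"
  shows "\<pi> 1 = Suc n \<or> \<pi> (Suc (run \<pi>)) = Suc n"
proof (rule disjCI)
  note perm = av_permutes[OF assms]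
  assume no: "\<pi> (Suc (run \<pi>)) \<noteq> Suc n"
  have "Suc n \<in> \<pi> ` {1..Suc n}"
    unfolding permutes_image[OF perm] by simp
  then obtain q where q: "1 \<le> q" "q \<le> Suc n" "\<pi> q = Suc n"
    by auto
  have "\<not> 1 < q"
  proof
    assume "1 < q"
    have "\<pi> (q - 1) \<noteq> \<pi> q"
      using permutes_inj_eq[OF perm] \<open>1 < q\<close> by simp
    moreover have "\<pi> (q - 1) \<le> Suc n"
      using q by (intro permutes_interval_le[OF perm]) simp
    ultimately have "\<pi> (q - 1) < \<pi> q"
      using q by simp
    moreover have "\<pi> (Suc i) \<le> \<pi> i" if "1 \<le> i" "i < q - 1" for i
    proof (rule ccontr)
      assume "\<not> \<pi> (Suc i) \<le> \<pi> i"
      moreover have "\<pi> (Suc i) \<noteq> \<pi> q"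
        unfolding permutes_inj_eq[OF perm] using that by simp
      moreover have "\<pi> (Suc i) \<le> Suc n"
        using that q by (intro permutes_interval_le[OF perm]) simp
      moreover have "Suc i < q"
        using that by linarith
      ultimately show False
        using av_no_123[OF assms, of i "Suc i" q] that(1) q by simp
    qed
    ultimately have "run \<pi> = q - 1"
      using \<open>1 < q\<close> by (intro run_eqI) auto
    then show False
      using no q \<open>1 < q\<close> by simp
  qed
  then show "\<pi> 1 = Suc n"
    using q by (metis le_antisym not_less)
qed

text \<open>
  The permutations with a given run are thus either those in which the maximum comes first, and the
  run is one longer than before, or those in which the maximum follows the run.
\<close>

lemma av_Suc_run_eq:
  assumes "1 \<le> n" "1 \<le> d"
  shows "{\<pi> \<in> av (Suc n). run \<pi> = d} =
           insert_max n 0 ` {\<pi> \<in> av n. run \<pi> = d - 1} \<union> insert_max n d ` {\<pi> \<in> av n. d \<le> run \<pi>}"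
    (is "?L = ?R")
proof
  show "?R \<subseteq> ?L"
    using assms insert_max_in_av run_insert_max_0 run_insert_max by auto
  show "?L \<subseteq> ?R"
  proof
    fix \<rho> assume "\<rho> \<in> ?L"
    then have \<rho>: "\<rho> \<in> av (Suc n)" "run \<rho> = d"
      by auto
    note perm = av_permutes[OF \<rho>(1)]
    from max_position[OF \<rho>(1)] show "\<rho> \<in> ?R"
    proof
      assume "\<rho> 1 = Suc n"
      then have "\<rho> \<in> insert_max n 0 ` {\<pi> \<in> av n. 0 \<le> run \<pi>}"
        using \<rho>(1) bij_betw_imp_surj_on[OF bij_betw_insert_max[OF assms(1), of 0]] by auto
      then obtain \<pi> where "\<pi> \<in> av n" "\<rho> = insert_max n 0 \<pi>"
        by auto
      moreover from this have "run \<pi> = d - 1"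
        using run_insert_max_0[of \<pi> n] \<rho>(2) assms(1) by simp
      ultimately show ?thesis
        by blast
    next
      assume *: "\<rho> (Suc (run \<rho>)) = Suc n"
      have "d \<le> n"
        using * \<rho> run_le[OF perm] permutes_interval_outside[OF perm, of "Suc (run \<rho>)"]
        by (cases "d = Suc n") auto
      then have "\<rho> \<in> insert_max n d ` {\<pi> \<in> av n. d \<le> run \<pi>}"
        using * \<rho> bij_betw_imp_surj_on[OF bij_betw_insert_max[OF assms(1), of d]] by auto
      then show ?thesis
        by blast
    qed
  qed
qed

lemma av_Suc_run_disjoint:
  assumes "1 \<le> n" "1 \<le> d"
  shows "insert_max n 0 ` {\<pi> \<in> av n. run \<pi> = d - 1} \<inter> insert_max n d ` {\<pi> \<in> av n. d \<le> run \<pi>} = {}"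
proof -
  have False if "\<pi> \<in> av n" "\<rho> \<in> av n" "d \<le> run \<rho>" "insert_max n 0 \<pi> = insert_max n d \<rho>" for \<pi> \<rho>
  proof -
    have "insert_max n d \<rho> 1 = Suc n"
      using fun_cong[OF that(4), of 1] by (simp add: insert_max_def)
    then have "\<rho> 1 = Suc n"
      using assms by (simp add: insert_max_def)
    then show False
      using permutes_interval_bounds[OF av_permutes[OF that(2)], of 1] assms by simp
  qed
  then show ?thesis
    by auto
qed

text \<open>
  The pair of entries at the positions \<open>j\<close> and \<open>j + 1\<close> is split by the new maximum, which creates an
  ascent in front of the maximum, unless it comes first, and a descent behind it, unless it comes last.
\<close>

lemma descent_set_insert_max:
  assumes "\<pi> \<in> av n" "1 \<le> n" "j \<le> n"
  shows "descent_set (Suc n) (insert_max n j \<pi>) =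
           {i \<in> descent_set n \<pi>. i < j} \<union> (if j < n then {Suc j} else {}) \<union> Suc ` {i \<in> descent_set n \<pi>. j < i}"
proof -
  note perm = av_permutes[OF assms(1)]
  note bounds = permutes_interval_bounds[OF perm]
  have "i \<in> descent_set (Suc n) (insert_max n j \<pi>) \<longleftrightarrow>
     (i \<in> descent_set n \<pi> \<and> i < j) \<or> (i = Suc j \<and> j < n) \<or> (\<exists>i'. i = Suc i' \<and> i' \<in> descent_set n \<pi> \<and> j < i')" for i
  proof -
    consider "i < j" | "i = j" | "i = Suc j" | i' where "i = Suc i'" "j < i'"
      by (metis Suc_lessE linorder_neqE_nat not_less_eq)
    then show ?thesis
    proof cases
      case 1
      then show ?thesis
        using assms(3) by (auto simp: descent_set_def insert_max_def)
    next
      case 2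
      then show ?thesis
        using bounds[of j] assms(3) by (auto simp: descent_set_def insert_max_def)
    next
      case 3
      then show ?thesis
        using bounds[of "Suc j"] by (auto simp: descent_set_def insert_max_def)
    next
      case (4 i')
      then show ?thesis
        by (auto simp: descent_set_def insert_max_def)
    qed
  qed
  then show ?thesis
    by (auto split: if_splits)
qed

lemma finite_descent_set: "finite (descent_set n \<pi>)"
  by (simp add: descent_set_def)

lemma des_insert_max:
  assumes "\<pi> \<in> av n" "1 \<le> n" "j \<le> n"
  shows "des (Suc n) (insert_max n j \<pi>) + (if j \<in> descent_set n \<pi> then 1 else 0)
           = des n \<pi> + (if j < n then 1 else 0)"
proof -
  let ?D = "descent_set n \<pi>"
  let ?lo = "{i \<in> ?D. i < j}" and ?hi = "{i \<in> ?D. j < i}"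
  have fin: "finite ?D"
    by (rule finite_descent_set)
  have "des (Suc n) (insert_max n j \<pi>) = card ?lo + card (if j < n then {Suc j} else {}) + card (Suc ` ?hi)"
    unfolding des_def descent_set_insert_max[OF assms] using fin
    by (subst card_Un_disjoint, auto)+
  also have "\<dots> = card ?lo + (if j < n then 1 else 0) + card ?hi"
    by (simp add: card_image)
  finally have 1: "des (Suc n) (insert_max n j \<pi>) = card ?lo + (if j < n then 1 else 0) + card ?hi" .
  have "?D = ?lo \<union> (if j \<in> ?D then {j} else {}) \<union> ?hi"
    by (auto simp: not_less le_less)
  then have "des n \<pi> = card (?lo \<union> (if j \<in> ?D then {j} else {}) \<union> ?hi)"
    by (simp add: des_def)
  also have "\<dots> = card ?lo + card (if j \<in> ?D then {j} else {}) + card ?hi"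
    using fin by (subst card_Un_disjoint, auto)+
  finally show ?thesis
    using 1 by simp
qed

lemma des_insert_max_le_run:
  assumes "\<pi> \<in> av n" "1 \<le> n" "j \<le> run \<pi>"
  shows "des (Suc n) (insert_max n j \<pi>) =
           (if j = 0 \<or> (j = run \<pi> \<and> j < n) then Suc (des n \<pi>) else des n \<pi>)"
proof -
  note perm = av_permutes[OF assms(1)]
  have "j \<in> descent_set n \<pi> \<longleftrightarrow> 1 \<le> j \<and> j < run \<pi>"
    using run_descent[OF perm, of j] run_ascent[OF perm assms(2)] run_le[OF perm assms(2)] assms(3)
    by (cases "j = run \<pi>") (auto simp: descent_set_def)
  then show ?thesis
    using des_insert_max[OF assms(1,2), of j] run_le[OF perm assms(2)] assms(2,3)
    by (auto split: if_splits)
qed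

section \<open>The recurrence for the distribution of descents by initial run\<close>

definition run_weight :: "'a::comm_ring_1 \<Rightarrow> nat \<Rightarrow> nat \<Rightarrow> 'a" where
  "run_weight t n d = (\<Sum>\<pi> | \<pi> \<in> av n \<and> run \<pi> = d. t ^ des n \<pi>)"

lemma run_weight_outside:
  assumes "1 \<le> n" "d = 0 \<or> n < d"
  shows "run_weight t n d = 0"
proof -
  have "{\<pi>. \<pi> \<in> av n \<and> run \<pi> = d} = {}"
    using run_ge_1[OF av_permutes] run_le[OF av_permutes] assms by fastforce
  then show ?thesis
    by (simp only: run_weight_def sum.empty)
qed

lemma sum_run_weight:
  assumes "1 \<le> n"
  shows "(\<Sum>\<pi> | \<pi> \<in> av n \<and> d < run \<pi>. t ^ des n \<pi>) = (\<Sum>e\<in>{d<..n}. run_weight t n e)"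
proof -
  have "(\<Sum>e\<in>{d<..n}. \<Sum>\<pi> | \<pi> \<in> {\<pi>. \<pi> \<in> av n \<and> d < run \<pi>} \<and> run \<pi> = e. t ^ des n \<pi>)
          = (\<Sum>\<pi> | \<pi> \<in> av n \<and> d < run \<pi>. t ^ des n \<pi>)"
    by (rule sum.group) (use finite_av run_le[OF av_permutes] assms in auto)
  moreover have "(\<Sum>\<pi> | \<pi> \<in> {\<pi>. \<pi> \<in> av n \<and> d < run \<pi>} \<and> run \<pi> = e. t ^ des n \<pi>) = run_weight t n e"
    if "e \<in> {d<..n}" for e
    unfolding run_weight_def using that by (intro sum.cong) auto
  ultimately show ?thesis
    by simp
qed

text \<open>
  The first summand comes from inserting the maximum in front. The others come from inserting it
  after \<open>d\<close> entries of a permutation whose run is at least \<open>d\<close>: this destroys a descent if the run is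
  longer than \<open>d\<close>, and an ascent if it is \<open>d\<close>. Only in the decreasing permutation, where
  \<open>d = n\<close>, is nothing destroyed and no descent created.
\<close>

lemma run_weight_Suc:
  assumes "1 \<le> n" "1 \<le> d"
  shows "run_weight t (Suc n) d = t * run_weight t n (d - 1)
           + (if d = n then 1 else t) * run_weight t n d + (\<Sum>e\<in>{d<..n}. run_weight t n e)"
proof -
  let ?A = "{\<pi> \<in> av n. run \<pi> = d - 1}" and ?B = "{\<pi> \<in> av n. d \<le> run \<pi>}"
  let ?w = "\<lambda>m \<pi>. t ^ des m \<pi>"
  have "inj_on (insert_max n 0) ?A"
    using bij_betw_imp_inj_on[OF bij_betw_insert_max[OF assms(1), of 0]] by (rule inj_on_subset) auto
  moreover have "inj_on (insert_max n d) ?B"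
  proof (cases "d \<le> n")
    case True
    then show ?thesis
      using bij_betw_imp_inj_on[OF bij_betw_insert_max[OF assms(1), of d]] by simp
  next
    case False
    then have "?B = {}"
      using run_le[OF av_permutes assms(1)] by fastforce
    then show ?thesis
      by (metis inj_on_empty)
  qed
  moreover have "run_weight t (Suc n) d =
      sum (?w (Suc n)) (insert_max n 0 ` ?A) + sum (?w (Suc n)) (insert_max n d ` ?B)"
    unfolding run_weight_def av_Suc_run_eq[OF assms]
    using finite_av by (intro sum.union_disjoint av_Suc_run_disjoint[OF assms]) auto
  ultimately have "run_weight t (Suc n) d =
      (\<Sum>\<pi>\<in>?A. ?w (Suc n) (insert_max n 0 \<pi>)) + (\<Sum>\<pi>\<in>?B. ?w (Suc n) (insert_max n d \<pi>))"
    by (simp add: sum.reindex)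
  also have "(\<Sum>\<pi>\<in>?A. ?w (Suc n) (insert_max n 0 \<pi>)) = t * run_weight t n (d - 1)"
    unfolding run_weight_def sum_distrib_left
    by (intro sum.cong) (auto simp: des_insert_max_le_run[OF _ assms(1)])
  also have "(\<Sum>\<pi>\<in>?B. ?w (Suc n) (insert_max n d \<pi>)) =
      (\<Sum>\<pi> | \<pi> \<in> av n \<and> run \<pi> = d. ?w (Suc n) (insert_max n d \<pi>))
        + (\<Sum>\<pi> | \<pi> \<in> av n \<and> d < run \<pi>. ?w (Suc n) (insert_max n d \<pi>))"
    using finite_av
    by (subst sum.union_disjoint[symmetric]) (auto intro!: sum.cong)
  also have "(\<Sum>\<pi> | \<pi> \<in> av n \<and> run \<pi> = d. ?w (Suc n) (insert_max n d \<pi>))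
      = (if d = n then 1 else t) * run_weight t n d"
    unfolding run_weight_def sum_distrib_left using assms run_le[OF av_permutes assms(1)]
    by (intro sum.cong) (force simp: des_insert_max_le_run[OF _ assms(1)])+
  also have "(\<Sum>\<pi> | \<pi> \<in> av n \<and> d < run \<pi>. ?w (Suc n) (insert_max n d \<pi>))
      = (\<Sum>\<pi> | \<pi> \<in> av n \<and> d < run \<pi>. ?w n \<pi>)"
    using assms by (intro sum.cong) (auto simp: des_insert_max_le_run[OF _ assms(1)])
  also have "\<dots> = (\<Sum>e\<in>{d<..n}. run_weight t n e)"
    by (rule sum_run_weight[OF assms(1)])
  finally show ?thesis
    by simp
qed

lemma av_1: "av 1 = {id}"
proof -
  have "\<pi> = id" if "\<pi> permutes {1..1::nat}" for \<pi>
    using permutes_interval_bounds[OF that] permutes_interval_zero[OF that] permutes_interval_outside[OF that]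
    by (metis eq_id_iff le_antisym less_one linorder_not_less)
  then show ?thesis
    by (auto simp: av_iff permutes_id simp del: One_nat_def id_apply)
qed

lemma run_id: "run id = 1"
  by (rule run_eqI) auto

lemma run_weight_1: "run_weight t 1 1 = 1"
proof -
  have "{\<pi>. \<pi> \<in> av 1 \<and> run \<pi> = 1} = {id}"
    using av_1 run_id by auto
  then show ?thesis
    unfolding run_weight_def by (simp add: des_def descent_set_def)
qed

lemma run_weight_diag: "1 \<le> n \<Longrightarrow> run_weight t n n = t ^ (n - 1)"
proof (induction n rule: nat_induct_at_least)
  case base
  show ?case by (metis run_weight_1 diff_self_eq_0 power_0)
next
  case (Suc n)
  then show ?case
    by (simp add: run_weight_Suc run_weight_outside power_eq_if)
qed

section \<open>The initial ascending run\<close>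

text \<open>
  If a permutation starts with an ascent, then avoiding 123 forces a descent at position 2,
  or the permutation ends there.
\<close>

lemma iar_av:
  assumes "\<pi> \<in> av n" "1 \<le> n"
  shows "iar n \<pi> = (if 2 \<le> n \<and> run \<pi> = 1 then 2 else 1)"
proof -
  note perm = av_permutes[OF assms(1)]
  have min: "iar n \<pi> = m" if "m \<in> descent_set n \<pi> \<union> {n}" "\<And>i. i \<in> descent_set n \<pi> \<union> {n} \<Longrightarrow> m \<le> i" for m
    unfolding iar_def using that by (intro Min_eqI) (auto simp: finite_descent_set)
  consider "n = 1" | "2 \<le> n" "run \<pi> = 1" | "2 \<le> n" "run \<pi> \<noteq> 1"
    using assms(2) by linarith
  then show ?thesis
  proof cases
    case 1
    then show ?thesis
      by (intro min) (auto simp: descent_set_def)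
  next
    case 2
    then have asc: "\<pi> 1 < \<pi> 2"
      using run_ascent[OF perm assms(2)] by (simp add: numeral_2_eq_2)
    have "2 \<in> descent_set n \<pi>" if "n \<noteq> 2"
    proof -
      have "\<not> \<pi> 2 < \<pi> 3"
        using av_no_123[OF assms(1), of 1 2 3] asc that 2 by auto
      then have "\<pi> 3 < \<pi> 2"
        using permutes_inj_eq[OF perm, of 2 3] by auto
      then show ?thesis
        using that 2 by (auto simp: descent_set_def)
    qed
    moreover have "1 \<notin> descent_set n \<pi>"
      using asc by (simp add: descent_set_def numeral_2_eq_2)
    then have "2 \<le> i" if "i \<in> descent_set n \<pi>" for i
      using that by (cases "i = 1") (auto simp: descent_set_def)
    ultimately have "iar n \<pi> = 2"
      using 2(1) by (intro min) auto
    then show ?thesis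
      using 2 by simp
  next
    case 3
    then have "1 < run \<pi>"
      using run_ge_1[OF perm assms(2)] by simp
    then have "1 \<in> descent_set n \<pi>"
      using run_descent[OF perm, of 1] 3(1) by (auto simp: descent_set_def)
    then have "iar n \<pi> = 1"
      using assms(2) by (intro min) (auto simp: descent_set_def)
    then show ?thesis
      using 3 by simp
  qed
qed

section \<open>Components\<close>

text \<open>
  The direct sum of the decreasing permutations of sizes \<open>k\<close> and \<open>n - k\<close>.
\<close>

definition two_dec :: "nat \<Rightarrow> nat \<Rightarrow> nat \<Rightarrow> nat" where
  "two_dec n k = (\<lambda>i. if 1 \<le> i \<and> i \<le> k then k + 1 - i
                      else if k < i \<and> i \<le> n then n + k + 1 - i else i)"

lemma two_dec_permutes:
  assumes "k < n"
  shows "two_dec n k permutes {1..n}"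
  using assms by (intro permutes_intervalI) (auto simp: two_dec_def)

lemma two_dec_in_av:
  assumes "k < n"
  shows "two_dec n k \<in> av n"
proof -
  have "False" if "1 \<le> a" "a < b" "b < c" "c \<le> n" "two_dec n k a < two_dec n k b" "two_dec n k b < two_dec n k c" for a b c
    using that assms by (auto simp: two_dec_def split: if_splits)
  then show ?thesis
    using two_dec_permutes[OF assms] by (auto simp: av_iff simp del: One_nat_def)
qed

lemma run_two_dec:
  assumes "1 \<le> k" "k < n"
  shows "run (two_dec n k) = k"
  using assms by (intro run_eqI) (auto simp: two_dec_def)

lemma des_two_dec:
  assumes "1 \<le> k" "k < n"
  shows "des n (two_dec n k) = n - 2"
proof -
  have "descent_set n (two_dec n k) = {1..n-1} - {k}"
    using assms by (auto simp: descent_set_def two_dec_def)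
  then show ?thesis
    using assms by (simp add: des_def)
qed

lemma comps_two_dec:
  assumes "1 \<le> k" "k < n"
  shows "comps n (two_dec n k) = 2"
proof -
  have "i = k \<or> i = n" if "1 \<le> i" "i \<le> n" "\<forall>j\<in>{1..i}. two_dec n k j \<le> i" for i
  proof (cases "i \<le> k")
    case True
    then show ?thesis
      using that(1) bspec[OF that(3), of 1] assms by (auto simp: two_dec_def)
  next
    case False
    then show ?thesis
      using that(1,2) bspec[OF that(3), of "Suc k"] assms by (auto simp: two_dec_def)
  qed
  moreover have "two_dec n k j \<le> k" if "1 \<le> j" "j \<le> k" for j
    using that by (simp add: two_dec_def)
  moreover have "two_dec n k j \<le> n" if "1 \<le> j" "j \<le> n" for j
    using permutes_interval_bounds[OF two_dec_permutes[OF assms(2)] that] by simp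
  ultimately have "{i \<in> {1..n}. \<forall>j\<in>{1..i}. two_dec n k j \<le> i} = {k, n}"
    using assms by (auto simp del: One_nat_def)
  then show ?thesis
    using assms by (simp add: comps_def)
qed

text \<open>
  In a strictly decreasing map, $f(i) + i$ is weakly decreasing; the bounds on $f$ at the two ends
  of the interval then squeeze it to the constant $l + u$.
\<close>

lemma decreasing_self_map:
  fixes f :: "nat \<Rightarrow> nat"
  assumes range: "\<And>i. l \<le> i \<Longrightarrow> i \<le> u \<Longrightarrow> l \<le> f i \<and> f i \<le> u"
    and dec: "\<And>i. l \<le> i \<Longrightarrow> i < u \<Longrightarrow> f (Suc i) < f i"
    and i: "l \<le> i" "i \<le> u"
  shows "f i = l + u - i"
proof -
  have "f i + i \<le> l + u"
    using i
  proof (induction i rule: dec_induct)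
    case base
    then show ?case using range[of l] by simp
  next
    case (step m)
    then show ?case using dec[of m] by simp
  qed
  moreover have "l + u \<le> f i + i"
    using i(2,1)
  proof (induction i rule: inc_induct)
    case base
    then show ?case using range[of u] by simp
  next
    case (step m)
    then show ?case using dec[of m] by simp
  qed
  ultimately show ?thesis
    by simp
qed

text \<open>
  An ascent in the first block would form a 123 with any entry of the second block, and an ascent in
  the second block would form one with any entry of the first. So both blocks decrease.
\<close>

lemma av_decomposable:
  assumes "\<pi> \<in> av n" "1 \<le> k" "k < n" "\<forall>j\<in>{1..k}. \<pi> j \<le> k"
  shows "\<pi> = two_dec n k"
proof -
  note perm = av_permutes[OF assms(1)]
  note bounds = permutes_interval_bounds[OF perm]
  have low: "1 \<le> \<pi> i \<and> \<pi> i \<le> k" if "1 \<le> i" "i \<le> k" for i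
    using that assms bounds[of i] by auto
  have "inj_on \<pi> {1..k}"
    using permutes_inj[OF perm] by (rule inj_on_subset) simp
  then have im: "\<pi> ` {1..k} = {1..k}"
    using low by (intro endo_inj_surj) auto
  have high: "Suc k \<le> \<pi> i \<and> \<pi> i \<le> n" if "Suc k \<le> i" "i \<le> n" for i
  proof (rule ccontr)
    assume "\<not> (Suc k \<le> \<pi> i \<and> \<pi> i \<le> n)"
    then have "\<pi> i \<in> \<pi> ` {1..k}"
      unfolding im using bounds[of i] that by auto
    then show False
      using that by (auto simp: permutes_inj_eq[OF perm])
  qed
  have "\<pi> i = 1 + k - i" if "1 \<le> i" "i \<le> k" for i
  proof (rule decreasing_self_map[OF _ _ that])
    fix i assume i: "1 \<le> i" "i < k"
    have "\<not> \<pi> i < \<pi> (Suc i)"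
      using av_no_123[OF assms(1), of i "Suc i" n] i assms(3) low[of "Suc i"] high[of n] by auto
    then show "\<pi> (Suc i) < \<pi> i"
      using permutes_inj_eq[OF perm, of i "Suc i"] by auto
  qed (use low in auto)
  moreover have "\<pi> i = Suc k + n - i" if "Suc k \<le> i" "i \<le> n" for i
  proof (rule decreasing_self_map[OF _ _ that])
    fix i assume i: "Suc k \<le> i" "i < n"
    have "\<not> \<pi> i < \<pi> (Suc i)"
      using av_no_123[OF assms(1), of 1 i "Suc i"] i assms(2) low[of 1] high[of i] by auto
    then show "\<pi> (Suc i) < \<pi> i"
      using permutes_inj_eq[OF perm, of i "Suc i"] by auto
  qed (use high in auto)
  ultimately show ?thesis
    using permutes_interval_outside[OF perm] permutes_interval_zero[OF perm]
    by (auto simp: fun_eq_iff two_dec_def not_less_eq_eq)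
qed

lemma comps_av:
  assumes "\<pi> \<in> av n" "1 \<le> n"
  shows "comps n \<pi> = (if \<pi> \<in> two_dec n ` {1..<n} then 2 else 1)"
proof (cases "\<pi> \<in> two_dec n ` {1..<n}")
  case True
  then show ?thesis
    using comps_two_dec by auto
next
  case False
  then have "\<not> (\<forall>j\<in>{1..i}. \<pi> j \<le> i)" if "1 \<le> i" "i < n" for i
    using av_decomposable[OF assms(1) that] that by auto
  moreover have "\<forall>j\<in>{1..n}. \<pi> j \<le> n"
    using permutes_interval_bounds[OF av_permutes[OF assms(1)]] by simp
  ultimately have "{i \<in> {1..n}. \<forall>j\<in>{1..i}. \<pi> j \<le> i} = {n}"
    using assms(2) by (auto simp: le_less simp del: One_nat_def)
  then show ?thesis
    using False by (simp add: comps_def)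
qed

text \<open>
  Counting one component for every permutation gives the first summand. The second one corrects $p$ to
  $p^2$ on the decomposable permutations, all of which have $n - 2$ descents.
\<close>

lemma sum_des_comps:
  fixes t p :: "'a::comm_ring_1"
  assumes "1 \<le> n"
  shows "(\<Sum>\<pi> | \<pi> \<in> av n \<and> Q (run \<pi>). t ^ des n \<pi> * p ^ comps n \<pi>) =
     p * (\<Sum>\<pi> | \<pi> \<in> av n \<and> Q (run \<pi>). t ^ des n \<pi>)
     + (p\<^sup>2 - p) * (of_nat (card {k \<in> {1..<n}. Q k}) * t ^ (n - 2))"
proof -
  let ?S = "{\<pi>. \<pi> \<in> av n \<and> Q (run \<pi>)}" and ?K = "{k \<in> {1..<n}. Q k}"
  have fin: "finite ?S"
    using finite_av by simp
  have inj: "inj_on (two_dec n) ?K"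
    using run_two_dec by (intro inj_on_inverseI[of _ run]) auto
  have "?S \<inter> two_dec n ` {1..<n} = two_dec n ` ?K"
    using run_two_dec two_dec_in_av by auto
  then have "(\<Sum>\<pi>\<in>?S. if \<pi> \<in> two_dec n ` {1..<n} then t ^ des n \<pi> else 0) = (\<Sum>\<pi>\<in>two_dec n ` ?K. t ^ des n \<pi>)"
    using fin by (simp add: sum.inter_restrict[symmetric])
  also have "\<dots> = (\<Sum>k\<in>?K. t ^ (n - 2))"
    using inj by (simp add: sum.reindex des_two_dec)
  also have "\<dots> = of_nat (card ?K) * t ^ (n - 2)"
    by simp
  finally have *: "(\<Sum>\<pi>\<in>?S. if \<pi> \<in> two_dec n ` {1..<n} then t ^ des n \<pi> else 0) = of_nat (card ?K) * t ^ (n - 2)" .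
  have "(\<Sum>\<pi>\<in>?S. t ^ des n \<pi> * p ^ comps n \<pi>) =
      (\<Sum>\<pi>\<in>?S. p * t ^ des n \<pi> + (p\<^sup>2 - p) * (if \<pi> \<in> two_dec n ` {1..<n} then t ^ des n \<pi> else 0))"
    by (intro sum.cong) (auto simp: comps_av[OF _ assms] algebra_simps)
  also have "\<dots> = p * (\<Sum>\<pi>\<in>?S. t ^ des n \<pi>) + (p\<^sup>2 - p) * (\<Sum>\<pi>\<in>?S. if \<pi> \<in> two_dec n ` {1..<n} then t ^ des n \<pi> else 0)"
    by (simp only: sum.distrib sum_distrib_left)
  finally show ?thesis
    unfolding * .
qed

section \<open>The solution of the recurrence\<close>

text \<open>
  In all series the indeterminate is $z$, written \<open>fps_X\<close>. The argument of the square root in $C^*$ is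
  $1 - 4tzw$ with the series $w$ below, so it is the discriminant of the equation
  $y = tz + w y^2$, and \<open>y_series\<close> is the root of this equation without constant term.
\<close>

definition w_series :: "'a::field_char_0 \<Rightarrow> 'a fps" where
  "w_series t = 1 + fps_X - fps_const t * fps_X"

definition disc_sqrt :: "'a::field_char_0 \<Rightarrow> 'a fps" where
  "disc_sqrt t = fps_sqrt (1 - 4 * fps_const t * fps_X - 4 * fps_const t * fps_X ^ 2
                             + 4 * fps_const t ^ 2 * fps_X ^ 2)"

definition y_series :: "'a::field_char_0 \<Rightarrow> 'a fps" where
  "y_series t = (1 - disc_sqrt t) * inverse (2 * w_series t)"

lemma w_series_nth_0: "w_series t $ 0 = 1"
  by (simp add: w_series_def)

lemma disc_sqrt: "disc_sqrt t ^ 2 = 1 - 4 * fps_const t * fps_X * w_series t" "disc_sqrt t $ 0 = 1"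
proof -
  let ?D = "1 - 4 * fps_const t * fps_X - 4 * fps_const t * fps_X ^ 2 + 4 * fps_const t ^ 2 * fps_X ^ 2 :: 'a fps"
  have "?D $ 0 = 1"
    by (simp add: power2_eq_square mult.assoc numeral_fps_const)
  from fps_sqrt_unique[OF this, of "disc_sqrt t"]
  have "disc_sqrt t ^ 2 = ?D" and *: "disc_sqrt t $ 0 = 1"
    by (auto simp: disc_sqrt_def)
  then show "disc_sqrt t ^ 2 = 1 - 4 * fps_const t * fps_X * w_series t"
    by (simp add: w_series_def algebra_simps power2_eq_square)
  show "disc_sqrt t $ 0 = 1"
    by (rule *)
qed

lemma y_series_sqrt: "2 * w_series t * y_series t = 1 - disc_sqrt t"
proof -
  have "(2 * w_series t) $ 0 \<noteq> 0"
    by (simp add: w_series_nth_0 numeral_fps_const)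
  then have "inverse (2 * w_series t) * (2 * w_series t) = 1"
    by (rule inverse_mult_eq_1)
  then show ?thesis
    by (simp add: y_series_def algebra_simps)
qed

lemma y_series_nth_0: "y_series t $ 0 = 0"
  by (simp add: y_series_def disc_sqrt)

lemma y_series_eq: "y_series t = fps_const t * fps_X + w_series t * (y_series t)\<^sup>2"
proof -
  let ?w = "w_series t" and ?y = "y_series t" and ?k = "fps_const t * fps_X"
  have "(1 - 2 * ?w * ?y)\<^sup>2 = 1 - 4 * ?k * ?w"
    using y_series_sqrt[of t] disc_sqrt(1)[of t] by (simp add: mult.assoc)
  then have "4 * ?w * (?y - (?k + ?w * ?y\<^sup>2)) = 0"
    by algebra
  moreover have "4 * ?w \<noteq> 0"
    using w_series_nth_0[of t] by (auto simp: fps_eq_iff intro: exI[of _ 0])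
  ultimately show ?thesis
    by simp
qed

text \<open>
  Two facts fix this shape. A nonzero sequence $c x^d$ solves the recurrence, apart from the term that stems
  from the decreasing permutations, exactly if $x = tz + z x^2/(1-x) + tzx$, that is, if $x$ is a root of
  $x = tz + w x^2$. That term is met by a multiple of $(tz)^d$. The two
  factors are determined by that term and by the value at \<open>d = 0\<close>: it is constant in $z$ because \<open>run\<close>
  is never 0, and the constant is $1/t$ because the permutation of size 1 has weight 1.
\<close>

definition run_series :: "'a::field_char_0 \<Rightarrow> nat \<Rightarrow> 'a fps" where
  "run_series t d =
     fps_const (inverse t) ^ 2 * inverse (w_series t) * (y_series t ^ d - (fps_const t * fps_X) ^ d)
     + fps_const (inverse t) * (fps_const t * fps_X) ^ d"

text \<open>
  The sum of \<open>run_series t e\<close> over all \<open>e > d\<close>, as a pair of geometric series.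
\<close>

definition tail_series :: "'a::field_char_0 \<Rightarrow> nat \<Rightarrow> 'a fps" where
  "tail_series t d =
     fps_const (inverse t) ^ 2 * inverse (w_series t) *
       (y_series t ^ Suc d * inverse (1 - y_series t)
        - (fps_const t * fps_X) ^ Suc d * inverse (1 - fps_const t * fps_X))
     + fps_const (inverse t) * (fps_const t * fps_X) ^ Suc d * inverse (1 - fps_const t * fps_X)"

lemma inverse_one_minus: "f $ 0 = 0 \<Longrightarrow> inverse (1 - f) * (1 - f) = (1 :: 'a::field fps)"
  by (rule inverse_mult_eq_1) simp

lemma inverse_w_series: "inverse (w_series t) * w_series t = 1"
  by (rule inverse_mult_eq_1) (simp add: w_series_nth_0)

lemma power_nth_below: "f $ 0 = 0 \<Longrightarrow> n < m \<Longrightarrow> (f ^ m) $ n = (0 :: 'a::comm_ring_1)"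
  by (simp add: startsby_zero_power_prefix)

lemma mult_nth_below:
  fixes f g :: "'a::comm_ring_1 fps"
  assumes "\<And>i. i \<le> n \<Longrightarrow> f $ i = 0"
  shows "(f * g) $ n = 0" "(g * f) $ n = 0"
  using assms by (auto simp: fps_mult_nth intro!: sum.neutral)

lemma run_series_nth_below:
  assumes "n < d"
  shows "run_series t d $ n = 0"
proof -
  have "(y_series t ^ d) $ i = 0" "((fps_const t * fps_X) ^ d) $ i = 0" if "i \<le> n" for i
    using that assms by (auto intro!: power_nth_below simp: y_series_nth_0)
  then show ?thesis
    by (simp add: run_series_def mult_nth_below)
qed

lemma tail_series_nth_below:
  assumes "n \<le> d"
  shows "tail_series t d $ n = 0"
proof -
  have "(y_series t ^ Suc d) $ i = 0" "((fps_const t * fps_X) ^ Suc d) $ i = 0" if "i \<le> n" for i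
    using that assms by (auto intro!: power_nth_below simp: y_series_nth_0 simp del: power_Suc)
  then have "(y_series t ^ Suc d * f) $ i = 0" "((fps_const t * fps_X) ^ Suc d * f) $ i = 0" if "i \<le> n" for f i
    using that by (meson mult_nth_below(1) order_trans)+
  then show ?thesis
    unfolding tail_series_def by (simp add: mult_nth_below mult.assoc del: power_Suc)
qed

lemma geometric_step:
  fixes f :: "'a::comm_ring_1"
  assumes "h * (1 - f) = 1"
  shows "f ^ Suc d * h = f ^ Suc d + f ^ Suc (Suc d) * h"
proof -
  have "f ^ Suc d * (h * (1 - f)) = f ^ Suc d"
    unfolding assms by simp
  then show ?thesis
    by (simp add: algebra_simps)
qed

lemma tail_series_step: "tail_series t d = run_series t (Suc d) + tail_series t (Suc d)"
proof -
  let ?I = "inverse (1 - y_series t)" and ?J = "inverse (1 - fps_const t * fps_X)"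
  have *: "y_series t ^ Suc d * ?I = y_series t ^ Suc d + y_series t ^ Suc (Suc d) * ?I"
    "(fps_const t * fps_X) ^ Suc d * ?J = (fps_const t * fps_X) ^ Suc d + (fps_const t * fps_X) ^ Suc (Suc d) * ?J"
    by (intro geometric_step inverse_one_minus; simp add: y_series_nth_0)+
  show ?thesis
    unfolding tail_series_def run_series_def mult.assoc[of _ _ ?J] * by (simp only: algebra_simps)
qed

text \<open>
  The coefficient of $z^n$ in \<open>run_series t e\<close> vanishes for \<open>e > n\<close>, so the finite sum is already the
  coefficient of the infinite one.
\<close>

lemma sum_run_series_nth: "(\<Sum>e\<in>{d<..n}. run_series t e $ n) = tail_series t d $ n"
proof (cases "d \<le> n")
  case True
  then show ?thesis
  proof (induction d rule: inc_induct)
    case base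
    then show ?case by (simp add: tail_series_nth_below)
  next
    case (step d)
    then have "{d<..n} = insert (Suc d) {Suc d<..n}"
      by auto
    then show ?case
      using step by (simp add: tail_series_step[of t d])
  qed
qed (simp add: tail_series_nth_below)

text \<open>
  The generating function form of \<open>run_weight_Suc\<close>. The last summand is the correction for the
  decreasing permutation: it occurs only for size \<open>d + 1\<close>, where the factor \<open>t\<close> has to be replaced by 1.
\<close>

lemma run_series_Suc:
  assumes "t \<noteq> 0"
  shows "run_series t (Suc d) = fps_const t * fps_X * run_series t d
     + fps_X * (tail_series t (Suc d) + fps_const t * run_series t (Suc d)
                + fps_const ((1 - t) * t ^ d) * fps_X ^ Suc d)"
proof -
  let ?w = "w_series t" and ?y = "y_series t" and ?T = "fps_const t" and ?U = "fps_const (inverse t)"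
  let ?I = "inverse (1 - ?y)" and ?J = "inverse (1 - ?T * fps_X)" and ?W = "inverse ?w"
  have T: "fps_const ((1 - t) * t ^ d) = (1 - ?T) * ?T ^ d"
    by (metis fps_const_1_eq_1 fps_const_mult fps_const_power fps_const_sub)
  let ?k = "?T * fps_X"
  have TU: "?T * ?U = 1"
    using assms by simp
  have I: "?I * (1 - ?y) = 1" and J: "?J * (1 - ?k) = 1" and W: "?W * ?w = 1"
    by (simp_all add: inverse_one_minus y_series_nth_0 inverse_w_series)
  have y: "?y = ?k + ?w * ?y\<^sup>2" and w: "?w = 1 + fps_X - ?k"
    by (fact y_series_eq, simp add: w_series_def)
  \<comment> \<open>The coefficients of the powers of $y$ and of $tz$ can be compared separately; the first comparison is the equation for $y$ multiplied by $1/(1-y)$.\<close>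
  have y_part: "?y = ?k + fps_X * (?y * ?y * ?I) + ?k * ?y"
    using I y w by algebra
  have k_part: "(?U - ?U ^ 2 * ?W) * ?k = (?U - ?U ^ 2 * ?W) * (?k + fps_X * (?k * ?k * ?J) + ?k * ?k)
      + (1 - ?T) * fps_X * fps_X"
    using TU J W w by algebra
  define P where "P = ?y ^ d"
  define Q where "Q = ?k ^ d"
  have Q: "(1 - ?T) * ?T ^ d * (fps_X * fps_X ^ d) = (1 - ?T) * fps_X * Q"
    by (simp only: Q_def power_mult_distrib power_Suc mult_ac)
  show ?thesis
    unfolding tail_series_def run_series_def T power_Suc P_def[symmetric] Q_def[symmetric] Q
    using y_part k_part by algebra
qed

lemma run_series_1:
  assumes "t \<noteq> 0"
  shows "run_series t 1 = fps_const (inverse t) ^ 2 * (y_series t)\<^sup>2 + fps_X"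
proof -
  have "fps_const t * fps_const (inverse t) = 1"
    using assms by simp
  then show ?thesis
    using inverse_w_series[of t] y_series_eq[of t] unfolding run_series_def power_one_right
    by algebra
qed

lemma tail_series_0:
  assumes "t \<noteq> 0"
  shows "fps_const t ^ 2 * fps_X * tail_series t 0 = y_series t - fps_const t * fps_X"
proof -
  let ?w = "w_series t" and ?y = "y_series t" and ?T = "fps_const t" and ?U = "fps_const (inverse t)"
  let ?I = "inverse (1 - ?y)" and ?J = "inverse (1 - ?T * fps_X)" and ?W = "inverse ?w"
  have "?T * ?U = 1"
    using assms by simp
  moreover have "?I * (1 - ?y) = 1" "?J * (1 - ?T * fps_X) = 1" "?W * ?w = 1"
    by (simp_all add: inverse_one_minus y_series_nth_0 inverse_w_series)
  moreover have "?y = ?T * fps_X + ?w * ?y\<^sup>2" "?w = 1 + fps_X - ?T * fps_X"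
    by (fact y_series_eq, simp add: w_series_def)
  ultimately show ?thesis
    unfolding tail_series_def power_Suc power_0 mult_1_right
    by algebra
qed

text \<open>
  Both sides equal $(y - tz)/t^2$: the left one by the equation for $y$, the right one by the closed form
  of the total sum. Combinatorially, removing the maximum from a permutation that starts with an
  ascent leaves an arbitrary one.
\<close>

lemma w_series_run_series_1:
  assumes "t \<noteq> 0"
  shows "w_series t * (run_series t 1 - fps_X) = fps_X * tail_series t 0"
proof -
  have "fps_const t * fps_const (inverse t) = 1"
    using assms by simp
  then show ?thesis
    using y_series_eq[of t] tail_series_0[OF assms] run_series_1[OF assms]
    by algebra
qed

text \<open>
  The equation $2wy = 1 - \sqrt{1 - 4tzw}$ turns $(y - tz)/(t^2 z)$ into $C^*$.
\<close>

lemma tail_series_C_star: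
  assumes "t \<noteq> 0"
  shows "fps_to_fls (tail_series t 0) = C_star t"
proof -
  let ?T = "fls_const t" and ?z = "fls_X :: 'a fls"
  let ?d = "2 * ?T ^ 2 * ?z * (?T * ?z - ?z - 1)"
  have w: "1 + fps_X - fps_const t * fps_X \<noteq> 0"
    using w_series_nth_0[of t] by (auto simp: w_series_def)
  have "fps_const t ^ 2 * fps_X * 2 * (1 + fps_X - fps_const t * fps_X) * tail_series t 0
      = 1 - disc_sqrt t - 2 * (1 + fps_X - fps_const t * fps_X) * fps_const t * fps_X"
    using tail_series_0[OF assms] y_series_sqrt[of t] unfolding w_series_def by algebra
  then have "fps_to_fls (fps_const t ^ 2 * fps_X * 2 * (1 + fps_X - fps_const t * fps_X) * tail_series t 0)
      = fps_to_fls (1 - disc_sqrt t - 2 * (1 + fps_X - fps_const t * fps_X) * fps_const t * fps_X)"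
    by simp
  then have "?T ^ 2 * ?z * 2 * (1 + ?z - ?T * ?z) * fps_to_fls (tail_series t 0)
      = 1 - fps_to_fls (disc_sqrt t) - 2 * (1 + ?z - ?T * ?z) * ?T * ?z"
    by (simp add: fls_times_fps_to_fls fps_to_fls_power algebra_simps flip: fls_const_power)
  then have "fps_to_fls (tail_series t 0) * ?d
      = - 1 + 2 * ?T * ?z + 2 * ?T * ?z ^ 2 - 2 * ?T ^ 2 * ?z ^ 2 + fps_to_fls (disc_sqrt t)"
    by algebra
  moreover have "?d \<noteq> 0"
  proof -
    have "fps_to_fls (1 + fps_X - fps_const t * fps_X) = 1 + ?z - ?T * ?z"
      by (simp add: fls_times_fps_to_fls)
    then have "1 + ?z - ?T * ?z \<noteq> 0"
      using w by (metis fps_to_fls_eq_0_iff)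
    moreover have "?T * ?z - ?z - 1 = - (1 + ?z - ?T * ?z)"
      by simp
    ultimately have "?T * ?z - ?z - 1 \<noteq> 0"
      by (simp only: neg_equal_0_iff_equal not_False_eq_True)
    then show ?thesis
      using assms by simp
  qed
  ultimately show ?thesis
    unfolding C_star_def disc_sqrt_def[symmetric] Let_def by (simp add: eq_divide_eq)
qed

text \<open>
  Both sides satisfy the same recurrence in \<open>n\<close>. In it, the weight of the decreasing
  permutation is known, which allows the coefficient that depends on \<open>d = n\<close> to be
  written as \<open>t\<close> plus a correction.
\<close>

lemma run_weight_eq_run_series:
  assumes "t \<noteq> 0" "1 \<le> n"
  shows "run_weight t n d = run_series t d $ n"
  using assms(2)
proof (induction n arbitrary: d rule: nat_induct_at_least)
  case base
  have "(y_series t)\<^sup>2 $ 1 = 0"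
    by (intro power_nth_below) (simp_all add: y_series_nth_0)
  then have "(fps_const (inverse t) ^ 2 * (y_series t)\<^sup>2) $ 1 = 0"
    by (simp only: fps_const_power fps_mult_left_const_nth mult_zero_right)
  then have "run_series t 1 $ 1 = 1"
    unfolding run_series_1[OF assms(1)] fps_add_nth by simp
  moreover have "run_series t 0 $ 1 = 0"
    by (simp add: run_series_def)
  moreover have "run_series t d $ 1 = 0" if "1 < d"
    using that by (rule run_series_nth_below)
  ultimately show ?case
    using run_weight_1[of t] run_weight_outside[of 1 d t]
    by (cases "d = 0"; cases "d = 1") auto
next
  case (Suc n)
  show ?case
  proof (cases d)
    case 0
    then show ?thesis
      using run_weight_outside[of "Suc n" 0 t] by (simp add: run_series_def)
  next
    case d: (Suc d')
    have "run_weight t (Suc n) d = t * run_series t d' $ n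
        + (if d = n then 1 else t) * run_series t d $ n + tail_series t d $ n"
      using run_weight_Suc[OF \<open>1 \<le> n\<close>, of d t] Suc.IH sum_run_series_nth[of t n d] d
      by simp
    also have "(if d = n then 1 else t) * run_series t d $ n
        = t * run_series t d $ n + (if d = n then (1 - t) * t ^ d' else 0)"
      using run_weight_diag[OF \<open>1 \<le> n\<close>, of t] Suc.IH[of n] d by (auto simp: algebra_simps)
    finally have "run_weight t (Suc n) d = t * run_series t d' $ n
        + (tail_series t d $ n + t * run_series t d $ n + (if d = n then (1 - t) * t ^ d' else 0))"
      by (simp add: algebra_simps)
    also have "\<dots> = run_series t d $ Suc n"
      using arg_cong[OF run_series_Suc[OF assms(1), of d'], of "\<lambda>f. f $ Suc n"] d
      by (auto simp: mult.assoc fps_X_power_nth)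
    finally show ?thesis .
  qed
qed

lemma sum_des_eq_tail_series:
  assumes "t \<noteq> 0" "1 \<le> n"
  shows "(\<Sum>\<pi>\<in>av n. t ^ des n \<pi>) = tail_series t 0 $ n"
proof -
  have "av n = {\<pi>. \<pi> \<in> av n \<and> 0 < run \<pi>}"
    using run_ge_1[OF av_permutes assms(2)] by fastforce
  then have "(\<Sum>\<pi>\<in>av n. t ^ des n \<pi>) = (\<Sum>\<pi> | \<pi> \<in> av n \<and> 0 < run \<pi>. t ^ des n \<pi>)"
    by simp
  then show ?thesis
    using assms by (simp add: sum_run_weight run_weight_eq_run_series sum_run_series_nth)
qed

section \<open>Generating functions by initial ascending run\<close>

definition iar_gf :: "nat \<Rightarrow> 'a::field_char_0 \<Rightarrow> 'a \<Rightarrow> 'a fps" where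
  "iar_gf m t p = Abs_fps (\<lambda>n. if n \<ge> m
     then \<Sum>\<pi> | \<pi> \<in> av n \<and> iar n \<pi> = m. t ^ des n \<pi> * p ^ comps n \<pi> else 0)"

text \<open>
  The descent generating functions of the decomposable permutations: \<open>split_series\<close> of those whose first
  summand has size 1 (\<open>iar = 2\<close>), and \<open>split_series'\<close> of the others (\<open>iar = 1\<close>).
\<close>

definition split_series :: "'a::comm_ring_1 \<Rightarrow> 'a fps" where
  "split_series t = Abs_fps (\<lambda>n. if 2 \<le> n then t ^ (n - 2) else 0)"

definition split_series' :: "'a::comm_ring_1 \<Rightarrow> 'a fps" where
  "split_series' t = Abs_fps (\<lambda>n. of_nat (n - 2) * t ^ (n - 2))"

lemma split_series: "(1 - fps_const t * fps_X) * split_series t = fps_X ^ 2"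
proof (rule fps_ext)
  fix n :: nat
  consider "n = 0" | "n = 1" | "n = 2" | m where "n = Suc (Suc (Suc m))"
    by (metis One_nat_def Suc_1 not0_implies_Suc)
  then show "((1 - fps_const t * fps_X) * split_series t) $ n = (fps_X ^ 2) $ n"
    by cases (simp_all add: split_series_def algebra_simps fps_X_power_nth)
qed

lemma split_series': "(1 - fps_const t * fps_X) * split_series' t = fps_const t * fps_X * split_series t"
proof (rule fps_ext)
  fix n :: nat
  consider "n = 0" | "n = 1" | "n = 2" | m where "n = Suc (Suc (Suc m))"
    by (metis One_nat_def Suc_1 not0_implies_Suc)
  then show "((1 - fps_const t * fps_X) * split_series' t) $ n = (fps_const t * fps_X * split_series t) $ n"
    by cases (simp_all add: split_series_def split_series'_def algebra_simps)
qed

lemma run_series_1_minus_X_nth: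
  assumes "t \<noteq> 0" "n < 2"
  shows "(run_series t 1 - fps_X) $ n = 0"
proof -
  have "(y_series t)\<^sup>2 $ n = 0"
    using assms by (intro power_nth_below) (simp_all add: y_series_nth_0)
  then show ?thesis
    unfolding run_series_1[OF assms(1)] by simp
qed

lemma iar_gf_2:
  assumes "t \<noteq> 0"
  shows "iar_gf 2 t p = fps_const p * (run_series t 1 - fps_X) + fps_const (p\<^sup>2 - p) * split_series t"
    (is "_ = ?R")
proof (rule fps_ext)
  fix n :: nat
  show "iar_gf 2 t p $ n = ?R $ n"
  proof (cases "2 \<le> n")
    case True
    then have "{\<pi>. \<pi> \<in> av n \<and> iar n \<pi> = 2} = {\<pi>. \<pi> \<in> av n \<and> run \<pi> = 1}"
      by (auto simp: iar_av split: if_splits)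
    moreover have "{k \<in> {1..<n}. k = 1} = {1}"
      using True by auto
    moreover have "(\<Sum>\<pi> | \<pi> \<in> av n \<and> run \<pi> = 1. t ^ des n \<pi>) = (run_series t 1 - fps_X) $ n"
      using True run_weight_eq_run_series[OF assms, of n 1] by (simp add: run_weight_def)
    ultimately show ?thesis
      using sum_des_comps[where Q = "\<lambda>d. d = 1" and n = n and t = t and p = p] True
      by (simp add: iar_gf_def split_series_def del: fps_sub_nth)
  next
    case False
    then show ?thesis
      using run_series_1_minus_X_nth[OF assms, of n] by (simp add: iar_gf_def split_series_def del: fps_sub_nth)
  qed
qed

lemma iar_gf_1:
  assumes "t \<noteq> 0"
  shows "iar_gf 1 t p = fps_const p * (tail_series t 0 - (run_series t 1 - fps_X))
           + fps_const (p\<^sup>2 - p) * split_series' t" (is "_ = ?R")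
proof (rule fps_ext)
  fix n :: nat
  consider "n = 0" | "n = 1" | "2 \<le> n"
    by linarith
  then show "iar_gf 1 t p $ n = ?R $ n"
  proof cases
    case 1
    then show ?thesis
      using run_series_1_minus_X_nth[OF assms, of n] tail_series_nth_below[of n 0 t]
      by (simp add: iar_gf_def split_series'_def)
  next
    case 2
    then have "{\<pi>. \<pi> \<in> av n \<and> iar n \<pi> = 1} = av n"
      by (auto simp: iar_av split: if_splits)
    then have "iar_gf 1 t p $ n = p * tail_series t 0 $ n"
      using sum_des_comps[where Q = "\<lambda>d. True" and n = n and t = t and p = p] sum_des_eq_tail_series[OF assms, of n] 2
      by (simp add: iar_gf_def)
    then show ?thesis
      using run_series_1_minus_X_nth[OF assms, of n] 2 by (simp add: split_series'_def)
  next
    case 3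
    have "{\<pi>. \<pi> \<in> av n \<and> iar n \<pi> = 1} = {\<pi>. \<pi> \<in> av n \<and> run \<pi> \<noteq> 1}"
      using 3 by (auto simp: iar_av split: if_splits)
    moreover have "{k \<in> {1..<n}. k \<noteq> 1} = {2..<n}"
      by auto
    moreover have "(\<Sum>\<pi> | \<pi> \<in> av n \<and> run \<pi> \<noteq> 1. t ^ des n \<pi>)
        = (tail_series t 0 - (run_series t 1 - fps_X)) $ n"
    proof -
      have "(\<Sum>\<pi>\<in>av n. t ^ des n \<pi>) = (\<Sum>\<pi> | \<pi> \<in> av n \<and> run \<pi> = 1. t ^ des n \<pi>)
          + (\<Sum>\<pi> | \<pi> \<in> av n \<and> run \<pi> \<noteq> 1. t ^ des n \<pi>)"
        using finite_av by (subst sum.union_disjoint[symmetric]) (auto intro!: sum.cong)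
      then show ?thesis
        using 3 run_weight_eq_run_series[OF assms, of n 1] sum_des_eq_tail_series[OF assms, of n]
        by (simp add: run_weight_def)
    qed
    ultimately show ?thesis
      using sum_des_comps[where Q = "\<lambda>d. d \<noteq> 1" and n = n and t = t and p = p] 3
      by (simp add: iar_gf_def split_series'_def del: fps_sub_nth)
  qed
qed

lemma av_0: "av 0 = {id}"
  by (auto simp: av_iff)

lemma gf_des_iar_comp_123:
  "gf_des_iar_comp {pattern_123} t r p =
     1 + fps_const r * iar_gf 1 t p + fps_const r ^ 2 * iar_gf 2 t p" (is "_ = ?R")
proof (rule fps_ext)
  fix n :: nat
  show "gf_des_iar_comp {pattern_123} t r p $ n = ?R $ n"
  proof (cases "n = 0")
    case True
    have "comps 0 id = 0"
      by (auto simp: comps_def)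
    with True show ?thesis
      by (simp add: gf_des_iar_comp_def av_0 iar_gf_def des_def descent_set_def iar_def)
  next
    case False
    let ?f = "\<lambda>\<pi>. t ^ des n \<pi> * p ^ comps n \<pi>"
    let ?S = "\<lambda>m. {\<pi>. \<pi> \<in> av n \<and> iar n \<pi> = m}"
    have "?S 2 = {}" if "\<not> 2 \<le> n"
      using that False by (auto simp: iar_av split: if_splits)
    then have two: "iar_gf 2 t p $ n = sum ?f (?S 2)"
      by (cases "2 \<le> n") (simp_all only: iar_gf_def fps_nth_Abs_fps sum.empty if_True if_False simp_thms)
    have "av n = ?S 1 \<union> ?S 2"
      using False by (auto simp: iar_av split: if_splits)
    then have "(\<Sum>\<pi>\<in>av n. t ^ des n \<pi> * r ^ iar n \<pi> * p ^ comps n \<pi>)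
        = (\<Sum>\<pi>\<in>?S 1 \<union> ?S 2. t ^ des n \<pi> * r ^ iar n \<pi> * p ^ comps n \<pi>)"
      by simp
    also have "\<dots> = (\<Sum>\<pi>\<in>?S 1. r * ?f \<pi>) + (\<Sum>\<pi>\<in>?S 2. r ^ 2 * ?f \<pi>)"
      using finite_av by (subst sum.union_disjoint) (auto simp: mult_ac)
    finally show ?thesis
      using False two by (simp add: gf_des_iar_comp_def iar_gf_def sum_distrib_left)
  qed
qed

section \<open>Solving for the generating functions\<close>

text \<open>
  Here \<open>a\<close>, \<open>b\<close>, \<open>g\<close> are the three series of the theorem, \<open>c\<close> is $C^*$, \<open>b1\<close> is the part of $zB$ at
  $p = 1$, and \<open>d\<close>, \<open>d'\<close> count the decomposable permutations. All of them are determined by \<open>c\<close>.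
\<close>

lemma solve_system:
  fixes t r p z a b b1 c d d' g :: "'a::field"
  assumes nz: "p \<noteq> 0" "z \<noteq> 0" "r \<noteq> 0" "1 - t * z \<noteq> 0" "1 - t * z + z \<noteq> 0"
    and a: "p * z * a = p * (c - b1) + (p\<^sup>2 - p) * d'" and b: "p * z * b = p * b1 + (p\<^sup>2 - p) * d"
    and b1: "(1 + z - t * z) * b1 = z * c"
    and d: "(1 - t * z) * d = z\<^sup>2" "(1 - t * z) * d' = t * z * d"
    and g: "g = (r * (p * z * a) + r\<^sup>2 * (p * z * b)) / (r * p * z)"
  shows "a = (p - 1) * t * z ^ 2 / (1 - t * z) ^ 2 + (1 - t * z) * c / ((1 - t * z + z) * z)"
    and "b = (p - 1) * z / (1 - t * z) + c / (1 - t * z + z)"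
    and "g = (1 - p) * z * (t * r * z - t * z - r) / (1 - t * z) ^ 2
              + (1 + r * z - t * z) * c / (z * (1 + z - t * z))"
proof -
  have b1': "b1 = z * c / (1 - t * z + z)"
    using b1 nz by (simp add: eq_divide_eq algebra_simps)
  have d1: "d = z\<^sup>2 / (1 - t * z)"
    using d nz by (simp add: eq_divide_eq algebra_simps)
  have "(1 - t * z) ^ 2 * d' = t * z * ((1 - t * z) * d)"
    using d(2) by (simp add: power2_eq_square mult_ac)
  then have d2: "d' = t * z ^ 3 / (1 - t * z) ^ 2"
    unfolding d(1) using nz by (simp add: eq_divide_eq power2_eq_square power3_eq_cube mult_ac)
  have "z * a = c - b1 + (p - 1) * d'" "z * b = b1 + (p - 1) * d"
    using a b nz(1) by algebra+
  then have az: "a = (c - b1 + (p - 1) * d') / z" and bz: "b = (b1 + (p - 1) * d) / z"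
    using nz(2) by (simp_all add: eq_divide_eq mult.commute)
  define u where "u = 1 - t * z"
  define w where "w = 1 - t * z + z"
  have uw: "u \<noteq> 0" "w \<noteq> 0" "w = u + z" "1 - t * z = u" "1 + z - t * z = w" "1 + r * z - t * z = u + r * z"
    using nz by (simp_all add: u_def w_def)
  have cb: "c - b1 = u * c / w"
    unfolding b1' uw(4) using uw(2,3) by (simp add: field_simps)
  show A: "a = (p - 1) * t * z ^ 2 / (1 - t * z) ^ 2 + (1 - t * z) * c / ((1 - t * z + z) * z)"
    unfolding az cb d2 uw(4) uw(3)[symmetric] using uw(1,2) nz(2) by (simp add: field_simps power2_eq_square power3_eq_cube)
  show B: "b = (p - 1) * z / (1 - t * z) + c / (1 - t * z + z)"
    unfolding bz b1' d1 uw(4) uw(3)[symmetric] using uw(1,2) nz(2) by (simp add: field_simps power2_eq_square)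
  have "g = a + r * b"
    unfolding g using nz by (simp add: field_simps power2_eq_square)
  also have "\<dots> = (p - 1) * z * (t * z + r * u) / u ^ 2 + (u + r * z) * c / (z * w)"
    unfolding A B uw(4) uw(3)[symmetric] using uw(1,2) nz(2) by (simp add: field_simps power2_eq_square)
  also have "(p - 1) * z * (t * z + r * u) = (1 - p) * z * (t * r * z - t * z - r)"
    by (simp add: u_def algebra_simps)
  finally show "g = (1 - p) * z * (t * r * z - t * z - r) / (1 - t * z) ^ 2
              + (1 + r * z - t * z) * c / (z * (1 + z - t * z))"
    unfolding uw(4,5,6) .
qed

lemma one_plus_X_mult_fls_nonzero: "fps_to_fls (1 + fps_X * f) \<noteq> (0 :: 'a::field fls)"
proof -
  have "(1 + fps_X * f) $ 0 \<noteq> (0 :: 'a)"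
    by simp
  then show ?thesis
    by (metis fps_to_fls_eq_0_iff fps_zero_nth)
qed

theorem theorem3p16:
  fixes A B :: "ratfun fps"
  assumes A: "fps_const p_var * fps_X * A =
      Abs_fps (\<lambda>n. if n \<ge> 1
        then \<Sum>\<pi> | \<pi> \<in> avoiders {pattern_123} n \<and> iar n \<pi> = 1. t_var ^ des n \<pi> * p_var ^ comps n \<pi>
        else 0)"
    and B: "fps_const p_var * fps_X * B =
      Abs_fps (\<lambda>n. if n \<ge> 2
        then \<Sum>\<pi> | \<pi> \<in> avoiders {pattern_123} n \<and> iar n \<pi> = 2. t_var ^ des n \<pi> * p_var ^ comps n \<pi>
        else 0)"
  shows "let t = fls_const t_var; r = fls_const r_var; p = fls_const p_var;
             z = fls_X; C = C_star t_var
         in fps_to_fls A =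
              (p - 1) * t * z ^ 2 / (1 - t * z) ^ 2 + (1 - t * z) * C / ((1 - t * z + z) * z)
          \<and> fps_to_fls B =
              (p - 1) * z / (1 - t * z) + C / (1 - t * z + z)
          \<and> gf_tilde {pattern_123} t_var r_var p_var =
              (1 - p) * z * (t * r * z - t * z - r) / (1 - t * z) ^ 2
              + (1 + r * z - t * z) * C / (z * (1 + z - t * z))"
proof -
  define t where "t = fls_const t_var"
  define r where "r = fls_const r_var"
  define p where "p = fls_const p_var"
  define z :: "ratfun fls" where "z = fls_X"
  define b1 where "b1 = fps_to_fls (run_series t_var 1 - fps_X)"
  define d where "d = fps_to_fls (split_series t_var)"
  define d' where "d' = fps_to_fls (split_series' t_var)"
  define g where "g = gf_tilde {pattern_123} t_var r_var p_var"
  note defs = t_def r_def p_def z_def b1_def d_def d'_def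
  note fls = fls_times_fps_to_fls fps_to_fls_power
  note tv = vars_nonzero(1)
  have A': "fps_const p_var * fps_X * A = iar_gf 1 t_var p_var"
    and B': "fps_const p_var * fps_X * B = iar_gf 2 t_var p_var"
    unfolding A B iar_gf_def by simp_all
  have nz: "p \<noteq> 0" "z \<noteq> 0" "r \<noteq> 0"
    using vars_nonzero by (simp_all add: defs)
  have "1 - t * z = fps_to_fls (1 + fps_X * (- fps_const t_var))"
    by (simp add: defs fls)
  then have nz1: "1 - t * z \<noteq> 0"
    using one_plus_X_mult_fls_nonzero[of "- fps_const t_var"] by (simp only: not_False_eq_True)
  have "1 - t * z + z = fps_to_fls (1 + fps_X * (1 - fps_const t_var))"
    by (simp add: defs fls algebra_simps)
  then have nz2: "1 - t * z + z \<noteq> 0"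
    using one_plus_X_mult_fls_nonzero[of "1 - fps_const t_var"] by (simp only: not_False_eq_True)
  have pp: "fls_const (p_var\<^sup>2 - p_var) = (fls_const p_var)\<^sup>2 - fls_const p_var"
    by (simp add: fls_const_power flip: fls_minus_const)
  have a: "p * z * fps_to_fls A = p * (C_star t_var - b1) + (p\<^sup>2 - p) * d'"
    using arg_cong[OF A'[unfolded iar_gf_1[OF tv]], of fps_to_fls]
    by (simp add: defs fls pp tail_series_C_star[OF tv])
  have b: "p * z * fps_to_fls B = p * b1 + (p\<^sup>2 - p) * d"
    using arg_cong[OF B'[unfolded iar_gf_2[OF tv]], of fps_to_fls]
    by (simp add: defs fls pp)
  have b1: "(1 + z - t * z) * b1 = z * C_star t_var"
    using arg_cong[OF w_series_run_series_1[OF tv], of fps_to_fls]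
    by (simp add: defs fls w_series_def tail_series_C_star[OF tv])
  have d: "(1 - t * z) * d = z\<^sup>2" "(1 - t * z) * d' = t * z * d"
    using arg_cong[OF split_series[of t_var], of fps_to_fls] arg_cong[OF split_series'[of t_var], of fps_to_fls]
    by (simp_all add: defs fls)
  have g: "g = (r * (p * z * fps_to_fls A) + r\<^sup>2 * (p * z * fps_to_fls B)) / (r * p * z)"
    unfolding g_def gf_tilde_def gf_des_iar_comp_123 A'[symmetric] B'[symmetric]
    by (simp add: defs fls fls_const_power)
  show ?thesis
    using solve_system[OF nz nz1 nz2 a b b1 d g]
    unfolding Let_def t_def[symmetric] r_def[symmetric] p_def[symmetric] z_def[symmetric] g_def[symmetric]
    by blast
qed

end
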